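(* Let $p$ be a prime. Then $$C(p,0)=\begin{cases}0&\text{if }p=2,\\(-1)^{\frac{p-1}{4}}&\text{if }p\equiv 1\pmod 4,\\(-1)^{\frac{p+1}{4}}&\text{if }p\equiv 3\pmod 4.\end{cases}$$
   Context: $C(n,x)$ is the minimal polynomial over $\mathbb Q$ of $2\cos(\pi/n)$, $n\in\mathbb N$. *)

theory Defs
  imports
    "HOL-Analysis.Analysis"
    "HOL-Computational_Algebra.Computational_Algebra"
    "HOL-Number_Theory.Cong"
begin

definition is_rat_minpoly :: "rat poly \<Rightarrow> 'a :: field_char_0 \<Rightarrow> bool" where
  "is_rat_minpoly q x \<longleftrightarrow>
     lead_coeff q = 1 \<and> poly (map_poly of_rat q) x = 0 \<and>
     (\<forall>r. r \<noteq> 0 \<and> poly (map_poly of_rat r) x = 0 \<longrightarrow> degree q \<le> degree r)"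

(* Unspecified if x is not algebraic. *)
definition rat_minpoly :: "'a :: field_char_0 \<Rightarrow> rat poly" where
  "rat_minpoly x = (THE q. is_rat_minpoly q x)"

definition C_poly :: "nat \<Rightarrow> rat poly" where
  "C_poly n = rat_minpoly (2 * cos (pi / real n))"

lemma poly_map_of_rat_add:
  "poly (map_poly of_rat (p + q)) (x :: 'a :: field_char_0) =
     poly (map_poly of_rat p) x + poly (map_poly of_rat q) x"
proof (induction p q rule: poly_induct2)
  case (pCons a p b q)
  then show ?case
    by (simp add: map_poly_pCons of_rat_add algebra_simps)
qed simp

lemma poly_map_of_rat_smult:
  "poly (map_poly of_rat (smult c q)) (x :: 'a :: field_char_0) =
     of_rat c * poly (map_poly of_rat q) x"
  by (induction q) (simp_all add: map_poly_pCons of_rat_mult algebra_simps)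

lemma poly_map_of_rat_diff:
  "poly (map_poly of_rat (p - q)) (x :: 'a :: field_char_0) =
     poly (map_poly of_rat p) x - poly (map_poly of_rat q) x"
  using poly_map_of_rat_add[of p "smult (-1) q" x] poly_map_of_rat_smult[of "-1" q x]
  by simp

lemma poly_map_of_rat_mult:
  "poly (map_poly of_rat (p * q)) (x :: 'a :: field_char_0) =
     poly (map_poly of_rat p) x * poly (map_poly of_rat q) x"
  by (induction p)
    (simp_all add: map_poly_pCons poly_map_of_rat_add poly_map_of_rat_smult algebra_simps)

lemma is_rat_minpoly_unique:
  fixes x :: "'a :: field_char_0"
  assumes "is_rat_minpoly p x" "is_rat_minpoly q x"
  shows "p = q"
proof (rule ccontr)
  assume ne: "p \<noteq> q"
  have p: "lead_coeff p = 1" and q: "lead_coeff q = 1"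
    using assms by (auto simp: is_rat_minpoly_def)
  then have nz: "p \<noteq> 0" "q \<noteq> 0" by auto
  have deg: "degree p = degree q"
    using assms nz by (auto simp: is_rat_minpoly_def intro!: antisym)
  have "poly (map_poly of_rat (p - q)) x = 0"
    using assms by (simp add: is_rat_minpoly_def poly_map_of_rat_diff)
  then have le: "degree p \<le> degree (p - q)"
    using assms(1) ne by (auto simp: is_rat_minpoly_def)
  have "degree (p - q) \<le> degree p"
    using deg by (simp add: degree_diff_le)
  with le have eq: "degree (p - q) = degree p" by simp
  have "coeff (p - q) (degree p) = 0"
    using p q deg by simp
  then have "lead_coeff (p - q) = 0" using eq by simp
  with ne show False by (simp only: leading_coeff_0_iff right_minus_eq)
qed

lemma is_rat_minpoly_exists:
  fixes x :: "'a :: field_char_0"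
  assumes "r \<noteq> 0" "poly (map_poly of_rat r) x = 0"
  shows "\<exists>q. is_rat_minpoly q x"
proof -
  define P where "P = (\<lambda>r. r \<noteq> 0 \<and> poly (map_poly of_rat r) x = 0)"
  have "P r" using assms by (simp add: P_def)
  then obtain s where s: "P s" and least: "\<And>t. P t \<Longrightarrow> degree s \<le> degree t"
    using ex_has_least_nat[of P r degree] by blast
  define q where "q = smult (inverse (lead_coeff s)) s"
  have "is_rat_minpoly q x"
    using s least by (auto simp: is_rat_minpoly_def q_def P_def poly_map_of_rat_smult)
  then show ?thesis ..
qed

lemma rat_minpoly_eqI:
  "is_rat_minpoly q x \<Longrightarrow> rat_minpoly x = q"
  unfolding rat_minpoly_def by (rule the_equality) (auto intro: is_rat_minpoly_unique)

lemma is_rat_minpoly_rat_minpoly: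
  fixes x :: "'a :: field_char_0"
  assumes "r \<noteq> 0" "poly (map_poly of_rat r) x = 0"
  shows "is_rat_minpoly (rat_minpoly x) x"
  using is_rat_minpoly_exists[OF assms] rat_minpoly_eqI by metis

lemma is_rat_minpoly_dvd:
  fixes x :: "'a :: field_char_0"
  assumes "is_rat_minpoly q x" "poly (map_poly of_rat r) x = 0"
  shows "q dvd r"
proof -
  have nz: "q \<noteq> 0" using assms(1) by (auto simp: is_rat_minpoly_def)
  have "r mod q = r - q * (r div q)"
    by (simp add: minus_mult_div_eq_mod)
  then have "poly (map_poly of_rat (r mod q)) x = 0"
    using assms by (simp add: is_rat_minpoly_def poly_map_of_rat_diff poly_map_of_rat_mult)
  then have "r mod q = 0"
    using assms(1) degree_mod_less[OF nz, of r] by (auto simp: is_rat_minpoly_def)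
  then show ?thesis by (simp add: dvd_eq_mod_eq_0)
qed

lemma is_rat_minpoly_iff_irreducible:
  fixes x :: "'a :: field_char_0"
  shows "is_rat_minpoly q x \<longleftrightarrow>
    lead_coeff q = 1 \<and> irreducible q \<and> poly (map_poly of_rat q) x = 0"
    (is "?L \<longleftrightarrow> ?R")
proof
  assume L: ?L
  then have lc: "lead_coeff q = 1" and root: "poly (map_poly of_rat q) x = 0"
    by (auto simp: is_rat_minpoly_def)
  have nz: "q \<noteq> 0" using lc by auto
  have "\<not> is_unit q"
  proof
    assume "is_unit q"
    then obtain c where "q = [:c:]" by (auto simp: is_unit_poly_iff)
    with lc root show False by (simp add: map_poly_pCons)
  qed
  moreover have "is_unit a \<or> is_unit b" if "q = a * b" for a b
  proof -
    have ab: "a \<noteq> 0" "b \<noteq> 0" using nz that by auto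
    from root that have "poly (map_poly of_rat a) x = 0 \<or> poly (map_poly of_rat b) x = 0"
      by (simp add: poly_map_of_rat_mult)
    with L ab have "degree q \<le> degree a \<or> degree q \<le> degree b"
      by (auto simp: is_rat_minpoly_def)
    then have "degree b = 0 \<or> degree a = 0"
      using that ab by (auto simp: degree_mult_eq)
    with ab show ?thesis by (auto simp: is_unit_iff_degree)
  qed
  ultimately have "irreducible q" using nz by (auto intro: irreducibleI)
  with lc root show ?R by simp
next
  assume R: ?R
  then have "q \<noteq> 0" by auto
  with R obtain m where m: "is_rat_minpoly m x"
    using is_rat_minpoly_exists by blast
  then have "m dvd q" using R is_rat_minpoly_dvd by blast
  have lcm: "lead_coeff m = 1" and rm: "poly (map_poly of_rat m) x = 0"
    using m by (auto simp: is_rat_minpoly_def)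
  have "\<not> is_unit m"
  proof
    assume "is_unit m"
    then obtain c where "m = [:c:]" by (auto simp: is_unit_poly_iff)
    with lcm rm show False by (simp add: map_poly_pCons)
  qed
  with R \<open>m dvd q\<close> have "q dvd m" using irreducibleD' by blast
  show ?L
    unfolding is_rat_minpoly_def
  proof (intro conjI allI impI)
    fix r :: "rat poly"
    assume r: "r \<noteq> 0 \<and> poly (map_poly of_rat r) x = 0"
    then have "q dvd r" using \<open>q dvd m\<close> is_rat_minpoly_dvd[OF m] dvd_trans by blast
    with r show "degree q \<le> degree r" using dvd_imp_degree_le by blast
  qed (use R in auto)
qed

end

theory Submission
  imports "Berlekamp_Zassenhaus.Factor_Bound" Defs
begin

text \<open>
  For odd \<open>p = 2n + 1\<close>, \<open>cos (p t / 2) / cos (t / 2)\<close> is a monic integer polynomial \<open>V\<close> of degree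
  \<open>n\<close> in \<open>y = 2 + 2 cos t\<close>, which vanishes at \<open>t = \<pi> / p\<close>. Its non-leading coefficients are
  divisible by \<open>p\<close> and its constant term is \<open>p\<close> up to sign, so it is irreducible by Eisenstein's
  criterion. Hence \<open>C(p, x) = V(x + 2)\<close>, and at \<open>x = 0\<close> the three-term recurrence for
  \<open>V\<close> reduces to \<open>a (k + 2) = - a k\<close>.
\<close>

(* Only with Defs imported last do coeff, monom, irreducible etc. denote the polynomial notions
   instead of their HOL-Algebra namesakes. *)

text \<open>Eisenstein's criterion combined with Gauss's lemma: in a factorization over the
  integers, \<open>p\<close> divides exactly one of the two constant terms, and that factor cannot
  have a cofactor of positive degree.\<close>

theorem irreducible_rat_eisenstein:
  fixes f :: "int poly" and p :: int
  assumes p: "prime p" and deg: "degree f > 0"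
    and dvd: "\<And>i. i < degree f \<Longrightarrow> p dvd coeff f i"
    and lead: "\<not> p dvd lead_coeff f" and const: "\<not> p\<^sup>2 dvd coeff f 0"
  shows "irreducible (map_poly rat_of_int f)"
proof (rule irreducibleI)
  have impossible: False
    if gh: "f = g * h" and dh: "degree h > 0" and pg: "p dvd coeff g 0" for g h
  proof -
    have "f \<noteq> 0" using deg by auto
    hence degf: "degree f = degree g + degree h" using gh by (simp add: degree_mult_eq)
    have ph: "\<not> p dvd coeff h 0"
      using const pg by (auto simp: gh coeff_mult power2_eq_square intro: mult_dvd_mono)
    have "\<not> p dvd lead_coeff g" using lead by (auto simp: gh lead_coeff_mult)
    \<comment> \<open>Modulo \<open>p\<close>, \<open>coeff f i\<close> reduces to
      \<open>coeff g i * coeff h 0\<close>, a non-multiple of \<open>p\<close>. Since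
      \<open>h\<close> is not constant, \<open>i < degree f\<close>, which is the
      contradiction.\<close>
    define i where "i = (LEAST i. \<not> p dvd coeff g i)"
    have i: "\<not> p dvd coeff g i" "i \<le> degree g"
      using \<open>\<not> p dvd lead_coeff g\<close> unfolding i_def by (rule LeastI, rule Least_le)
    have least: "p dvd coeff g k" if "k < i" for k
      using that not_less_Least unfolding i_def by blast
    have "coeff f i = (\<Sum>k<i. coeff g k * coeff h (i - k)) + coeff g i * coeff h 0"
      by (simp add: gh coeff_mult atMost_Suc lessThan_Suc_atMost[symmetric])
    moreover have "p dvd (\<Sum>k<i. coeff g k * coeff h (i - k))"
      by (intro dvd_sum) (simp add: least)
    moreover have "p dvd coeff f i" using i(2) degf dh by (intro dvd) simp
    ultimately have "p dvd coeff g i * coeff h 0" by (simp add: dvd_add_right_iff)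
    thus False using p ph i(1) by (auto dest: prime_dvd_multD)
  qed
  show "map_poly rat_of_int f \<noteq> 0" using deg by auto
  show "\<not> map_poly rat_of_int f dvd 1" using deg by (auto simp: poly_dvd_1)
  fix a b assume "map_poly rat_of_int f = a * b"
  \<comment> \<open>Gauss's lemma: the rational factorization lifts to an integral one with the same
    degrees.\<close>
  from rat_to_int_factor[OF this] obtain g h
    where gh: "f = g * h" "degree g = degree a" "degree h = degree b" by blast
  have nz: "a \<noteq> 0" "b \<noteq> 0"
    using \<open>map_poly rat_of_int f = a * b\<close> deg by auto
  have "p dvd coeff g 0 * coeff h 0" using dvd[OF deg] by (simp add: gh(1) coeff_mult)
  hence "p dvd coeff g 0 \<or> p dvd coeff h 0" using p prime_dvd_multD by blast
  hence "degree h = 0 \<or> degree g = 0"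
    using impossible[of g h] impossible[of h g] gh(1) by (auto simp: mult.commute)
  thus "a dvd 1 \<or> b dvd 1" using gh nz by (auto simp: is_unit_iff_degree)
qed

lemma poly_map_of_rat_shift:
  "poly (map_poly of_rat (pcompose r [:a, 1:])) (x :: 'a :: field_char_0) =
     poly (map_poly of_rat r) (x + of_rat a)"
  by (induction r)
    (simp_all add: pcompose_pCons Polynomial.map_poly_pCons poly_map_of_rat_add
      poly_map_of_rat_mult poly_map_of_rat_smult algebra_simps del: pCons_one)

text \<open>Substituting \<open>X + a\<close> preserves degrees and is undone by substituting
  \<open>X - a\<close>, so a competitor of smaller degree at \<open>x\<close> would give one at
  \<open>x + a\<close>.\<close>

lemma is_rat_minpoly_shift:
  assumes "is_rat_minpoly q (x + of_rat a)"
  shows "is_rat_minpoly (pcompose q [:a, 1:]) x"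
  unfolding is_rat_minpoly_def
proof (intro conjI allI impI)
  show "lead_coeff (pcompose q [:a, 1:]) = 1"
    using assms lead_coeff_comp[of "[:a, 1:]" q] by (simp add: is_rat_minpoly_def)
  show "poly (map_poly of_rat (pcompose q [:a, 1:])) x = 0"
    using assms by (simp add: is_rat_minpoly_def poly_map_of_rat_shift del: pCons_one)
  fix r assume r: "r \<noteq> 0 \<and> poly (map_poly of_rat r) x = 0"
  have "pcompose r [:- a, 1:] \<noteq> 0" using r by (simp add: pcompose_eq_0_iff)
  moreover have "poly (map_poly of_rat (pcompose r [:- a, 1:])) (x + of_rat a) = 0"
    using r by (simp add: poly_map_of_rat_shift of_rat_minus del: pCons_one)
  ultimately have "degree q \<le> degree (pcompose r [:- a, 1:])"
    using assms unfolding is_rat_minpoly_def by blast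
  thus "degree (pcompose q [:a, 1:]) \<le> degree r" by simp
qed

text \<open>The variable is \<open>2 + 2 cos t\<close> rather than \<open>2 cos t\<close>: only in this form does Eisenstein apply.\<close>

fun half_cos_poly :: "nat \<Rightarrow> int poly" where
  "half_cos_poly 0 = 1"
| "half_cos_poly (Suc 0) = [:-3, 1:]"
| "half_cos_poly (Suc (Suc n)) = [:-2, 1:] * half_cos_poly (Suc n) - half_cos_poly n"

text \<open>The recurrence is the sum formula for two cosines whose arguments differ by
  \<open>2 * t\<close>; its factor \<open>2 * cos t\<close> is \<open>y - 2\<close> for
  \<open>y = 2 * cos t + 2\<close>.\<close>

lemma cos_odd_half:
  "cos (real (2 * n + 1) * (t / 2)) =
     poly (map_poly of_int (half_cos_poly n)) (2 * cos t + 2) * cos (t / 2)"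
proof (induction n rule: half_cos_poly.induct)
  case 1
  show ?case by simp
next
  case 2
  have "cos (3 * (t / 2)) + cos (t / 2) = 2 * cos t * cos (t / 2)"
    using cos_plus_cos[of "3 * (t / 2)" "t / 2"] by simp
  thus ?case by (simp add: Polynomial.map_poly_pCons algebra_simps)
next
  case (3 n)
  have "cos (real (2 * Suc (Suc n) + 1) * (t / 2)) + cos (real (2 * n + 1) * (t / 2)) =
      2 * cos t * cos (real (2 * Suc n + 1) * (t / 2))"
    using cos_add[of "real (2 * Suc n + 1) * (t / 2)" t]
      cos_diff[of "real (2 * Suc n + 1) * (t / 2)" t]
    by (simp add: algebra_simps)
  with 3 show ?case
    by (simp add: hom_distribs Polynomial.map_poly_pCons algebra_simps)
qed

text \<open>Follows from the recurrence by Pascal's rule. The closed form gives the constant term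
  \<open>(-1) ^ n * (2 * n + 1)\<close> and makes divisibility by \<open>2 * n + 1\<close>
  accessible.\<close>

lemma coeff_half_cos_poly:
  "coeff (half_cos_poly n) j =
     (-1) ^ (n + j) * int (((n + j) choose (2 * j)) + 2 * ((n + j) choose (2 * j + 1)))"
proof (induction n arbitrary: j rule: half_cos_poly.induct)
  case 1
  show ?case by (cases j) (auto simp: binomial_eq_0)
next
  case 2
  show ?case
  proof (cases j)
    case (Suc k)
    thus ?thesis by (cases k) (auto simp: binomial_eq_0 numeral_2_eq_2)
  qed simp
next
  case (3 n)
  show ?case
    by (cases j) (simp_all add: 3 algebra_simps)
qed

lemma degree_half_cos_poly: "degree (half_cos_poly n) = n"
  by (rule antisym[OF degree_le le_degree])
    (auto simp: coeff_half_cos_poly binomial_eq_0)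

lemma lead_coeff_half_cos_poly: "lead_coeff (half_cos_poly n) = 1"
  by (simp add: degree_half_cos_poly coeff_half_cos_poly mult_2[symmetric])

text \<open>The factor \<open>[:-2, 1:]\<close> vanishes at 2, so each parity class alternates in
  sign, starting from 1 and -1 respectively.\<close>

lemma poly_half_cos_poly_2:
  "poly (half_cos_poly (2 * k)) 2 = (-1) ^ k"
  "poly (half_cos_poly (2 * k + 1)) 2 = (-1) ^ (k + 1)"
  by (induction k) auto

lemma prime_dvd_coeff_half_cos_poly:
  assumes p: "prime (2 * n + 1)" and j: "j < n"
  shows "int (2 * n + 1) dvd coeff (half_cos_poly n) j"
proof -
  \<comment> \<open>Up to sign, the coefficient equals \<open>(2n + 1) / (2j + 1)\<close> times a binomial coefficient.\<close>
  have "(2 * j + 1) * ((n + j) choose (2 * j + 1)) = (n - j) * ((n + j) choose (2 * j))"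
    using binomial_absorb_comp[of "n + j" "2 * j"] binomial_absorption[of "2 * j" "n + j"] j
    by simp
  hence "(2 * j + 1) * (((n + j) choose (2 * j)) + 2 * ((n + j) choose (2 * j + 1))) =
      (2 * j + 1 + 2 * (n - j)) * ((n + j) choose (2 * j))"
    by (simp add: algebra_simps)
  also have "2 * j + 1 + 2 * (n - j) = 2 * n + 1" using j by simp
  finally have "(2 * n + 1) dvd
      (2 * j + 1) * (((n + j) choose (2 * j)) + 2 * ((n + j) choose (2 * j + 1)))"
    by (rule dvdI)
  moreover have "\<not> (2 * n + 1) dvd (2 * j + 1)" using j by (auto dest: dvd_imp_le)
  ultimately have "(2 * n + 1) dvd (((n + j) choose (2 * j)) + 2 * ((n + j) choose (2 * j + 1)))"
    using p prime_dvd_multD by blast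
  thus ?thesis unfolding coeff_half_cos_poly by (intro dvd_mult) (simp only: of_nat_dvd_iff)
qed

lemma irreducible_half_cos_poly:
  assumes p: "prime (2 * n + 1)"
  shows "irreducible (map_poly rat_of_int (half_cos_poly n))"
proof (rule irreducible_rat_eisenstein)
  have n: "n > 0" using p by (cases n) auto
  show "prime (int (2 * n + 1))" using p by (simp only: prime_nat_int_transfer)
  show "degree (half_cos_poly n) > 0" using n by (simp add: degree_half_cos_poly)
  show "int (2 * n + 1) dvd coeff (half_cos_poly n) i" if "i < degree (half_cos_poly n)" for i
    using that p by (intro prime_dvd_coeff_half_cos_poly) (simp_all add: degree_half_cos_poly)
  show "\<not> int (2 * n + 1) dvd lead_coeff (half_cos_poly n)"
    using n by (subst lead_coeff_half_cos_poly) simp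
  \<comment> \<open>The constant term is the prime times this unit, so the square of the prime
    cannot divide it.\<close>
  have "\<not> int (2 * n + 1) dvd (-1) ^ n"
    using n by (cases "even n") simp_all
  thus "\<not> (int (2 * n + 1))\<^sup>2 dvd coeff (half_cos_poly n) 0"
    by (simp add: coeff_half_cos_poly power2_eq_square)
qed

lemma C_poly_odd_prime:
  assumes p: "prime (2 * n + 1)"
  shows "C_poly (2 * n + 1) = pcompose (map_poly of_int (half_cos_poly n)) [:2, 1:]"
proof -
  let ?x = "2 * cos (pi / real (2 * n + 1))"
  have n: "n > 0" using p by (cases n) auto
  \<comment> \<open>At \<open>t = pi / p\<close> the left side of \<open>cos_odd_half\<close> is
    \<open>cos (pi / 2) = 0\<close>; as \<open>cos (t / 2)\<close> is nonzero, the polynomial factor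
    must vanish.\<close>
  have "pi / real (2 * n + 1) / 2 < pi / 2" "0 < pi / real (2 * n + 1) / 2"
    using n by (simp_all add: field_simps)
  hence "cos (pi / real (2 * n + 1) / 2) \<noteq> 0"
    using cos_gt_zero[of "pi / real (2 * n + 1) / 2"] by linarith
  moreover have "cos (real (2 * n + 1) * (pi / real (2 * n + 1) / 2)) = 0"
    by (simp only: times_divide_eq_right nonzero_mult_div_cancel_left of_nat_eq_0_iff) simp
  ultimately have "poly (map_poly of_int (half_cos_poly n)) (?x + 2) = 0"
    using cos_odd_half[of n "pi / real (2 * n + 1)"] by simp
  hence "poly (map_poly of_rat (map_poly rat_of_int (half_cos_poly n))) (?x + of_rat 2) = 0"
    by (simp add: map_poly_map_poly o_def)
  hence "is_rat_minpoly (map_poly of_int (half_cos_poly n)) (?x + of_rat 2)"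
    unfolding is_rat_minpoly_iff_irreducible
    using irreducible_half_cos_poly[OF p] by (simp add: lead_coeff_half_cos_poly)
  thus ?thesis unfolding C_poly_def by (intro rat_minpoly_eqI is_rat_minpoly_shift)
qed

lemma C_poly_odd_prime_0:
  assumes "prime (2 * n + 1)"
  shows "poly (C_poly (2 * n + 1)) 0 = of_int (poly (half_cos_poly n) 2)"
proof -
  have "poly (map_poly rat_of_int f) (of_int 2) = of_int (poly f 2)" for f
    by (rule of_int_hom.poly_map_poly)
  thus ?thesis by (subst C_poly_odd_prime[OF assms]) (simp add: poly_pcompose)
qed

lemma C_poly_2: "C_poly 2 = [:0, 1:]"
  unfolding C_poly_def
  by (intro rat_minpoly_eqI)
    (auto simp: is_rat_minpoly_iff_irreducible Polynomial.map_poly_pCons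
      intro: irreducible_linear_field_poly simp del: pCons_one)

theorem proposition8:
  fixes p :: nat
  assumes "prime p"
  shows "(p = 2 \<longrightarrow> poly (C_poly p) 0 = 0) \<and>
         ([p = 1] (mod 4) \<longrightarrow> poly (C_poly p) 0 = (-1) ^ ((p - 1) div 4)) \<and>
         ([p = 3] (mod 4) \<longrightarrow> poly (C_poly p) 0 = (-1) ^ ((p + 1) div 4))"
proof (intro conjI impI)
  show "poly (C_poly p) 0 = 0" if "p = 2" using that by (simp add: C_poly_2)
  show "poly (C_poly p) 0 = (-1) ^ ((p - 1) div 4)" if "[p = 1] (mod 4)"
  proof -
    define k where "k = p div 4"
    \<comment> \<open>Here the index \<open>(p - 1) / 2\<close> is even, and the exponent
      \<open>(p - 1) div 4\<close> is \<open>k\<close>.\<close>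
    have p: "p = 2 * (2 * k) + 1" using that unfolding Cong.cong_def k_def by presburger
    thus ?thesis
      using C_poly_odd_prime_0[of "2 * k"] assms by (simp add: poly_half_cos_poly_2)
  qed
  show "poly (C_poly p) 0 = (-1) ^ ((p + 1) div 4)" if "[p = 3] (mod 4)"
  proof -
    define k where "k = p div 4"
    \<comment> \<open>Now the index is odd, so the sequence starting from -1 applies and shifts the
      exponent to \<open>k + 1\<close>.\<close>
    have p: "p = 2 * (2 * k + 1) + 1" using that unfolding Cong.cong_def k_def by presburger
    hence "(p + 1) div 4 = k + 1" by simp
    thus ?thesis
      using C_poly_odd_prime_0[of "2 * k + 1"] assms p poly_half_cos_poly_2(2)[of k] by simp
  qed
qed

end
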